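(* Let $L>0$ be such that $G(L)>0$, and let $f\in\mathcal C_L$ be such that $\Delta(f)=G(L)$. If $\hat X$ is a random vector with values in $\mathrm{Im} f$ such that $\|X-\hat X\|=d(X,\mathrm{Im} f)$ a.s., then $$\mathbb P\left(\mathbb E[X\mid\hat X]\ne\hat X\right)>0 .$$
   Context: Let $d\ge1$, and let $\mathbb R^d$ carry the Euclidean norm $\|\cdot\|$; $d(x,A)=\inf_{y\in A}\|x-y\|$. Let $X$ be a random vector on a probability space $(\Omega,\mathcal F,\mathbb P)$ with values in $\mathbb R^d$ and $\mathbb E[\|X\|^2]<\infty$; $\hat X$ is defined on the same probability space as $X$. A curve is a continuous function $f:[0,1]\to\mathbb R^d$; its image is $\mathrm{Im} f$ and its length is $\mathscr L(f)=\sup\sum_{i=1}^n\|f(t_i)-f(t_{i-1})\|\in[0,\infty]$, the supremum being over all subdivisions $0=t_0\le\dots\le t_n=1$, $n\ge1$. Set $\Delta(f)=\mathbb E[d(X,\mathrm{Im} f)^2]$. For $L\ge0$, $\mathcal C_L$ denotes either one of the two sets $\{f:[0,1]\to\mathbb R^d \text{ curve},\ \mathscr L(f)\le L\}$ (open case) or $\{f:[0,1]\to\mathbb R^d\text{ curve},\ \mathscr L(f)\le L,\ f(0)=f(1)\}$ (closed case); the result is asserted for each of the two choices. $G(L)=\min\{\Delta(f): f\in\mathcal C_L\}$ (the minimum is attained). *)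

theory Defs
  imports "HOL-Probability.Probability"
begin

text \<open>
  A curve is the library's \<^const>\<open>path\<close>: a function on the reals that is continuous on
  \<open>{0..1}\<close>. Every notion below depends only on its values on \<open>{0..1}\<close>.
\<close>

definition subdivisions :: "(nat \<times> (nat \<Rightarrow> real)) set" where
  "subdivisions = {(n, t). n \<ge> 1 \<and> t 0 = 0 \<and> t n = 1 \<and> (\<forall>i\<in>{1..n}. t (i - 1) \<le> t i)}"

definition curve_length :: "(real \<Rightarrow> real ^ 'd) \<Rightarrow> ennreal" where
  "curve_length f = (SUP (n, t)\<in>subdivisions. \<Sum>i=1..n. ennreal (norm (f (t i) - f (t (i - 1)))))"

definition open_curves :: "real \<Rightarrow> (real \<Rightarrow> real ^ 'd) set" where
  "open_curves L = {f. path f \<and> curve_length f \<le> ennreal L}"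

definition closed_curves :: "real \<Rightarrow> (real \<Rightarrow> real ^ 'd) set" where
  "closed_curves L = {f. path f \<and> curve_length f \<le> ennreal L \<and> pathstart f = pathfinish f}"

definition distortion :: "'w measure \<Rightarrow> ('w \<Rightarrow> real ^ 'd) \<Rightarrow> (real \<Rightarrow> real ^ 'd) \<Rightarrow> real" where
  "distortion M X f = (\<integral>\<omega>. (infdist (X \<omega>) (path_image f))\<^sup>2 \<partial>M)"

text \<open>
  The values of \<^const>\<open>distortion\<close> are bounded below by 0, and both classes of curves contain
  the constant curves when \<open>L \<ge> 0\<close>, so the infimum is a genuine one; it is the minimum as soon
  as some curve of the class attains it.
\<close>

definition min_distortion ::
    "'w measure \<Rightarrow> ('w \<Rightarrow> real ^ 'd) \<Rightarrow> (real \<Rightarrow> real ^ 'd) set \<Rightarrow> real" where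
  "min_distortion M X C = (INF f\<in>C. distortion M X f)"

text \<open>
  The conditional expectation of a random vector given the sigma-algebra generated by \<open>Y\<close>.
  The library provides real-valued conditional expectations, so it is taken coordinatewise.
\<close>

definition cond_exp_given ::
    "'w measure \<Rightarrow> ('w \<Rightarrow> real ^ 'd) \<Rightarrow> ('w \<Rightarrow> real ^ 'd) \<Rightarrow> 'w \<Rightarrow> real ^ 'd" where
  "cond_exp_given M X Y \<omega> =
     (\<chi> i. real_cond_exp M (vimage_algebra (space M) Y borel) (\<lambda>\<omega>'. X \<omega>' $ i) \<omega>)"

end

theory Submission
  imports Defs
begin

text \<open>
  Write \<open>v = X - Xhat\<close> and suppose that \<open>E[X | Xhat] = Xhat\<close> almost surely. Then \<open>v\<close> is orthogonal
  in \<open>L\<^sup>2\<close> to every bounded Borel function of \<open>Xhat\<close> (\<open>residual_orthogonal\<close>). Consequently, moving the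
  curve by an amount that depends on the point of the curve only has no first-order effect on the
  distortion: shrinking \<open>f\<close> by the factor \<open>1 - \<epsilon>\<close> costs only \<open>O(\<epsilon>\<^sup>2)\<close>, whereas it frees the length
  \<open>\<epsilon> L\<close>. The contradiction comes from spending this length so that the distortion drops by
  much more than \<open>\<epsilon>\<^sup>2\<close>.

  The length is spent on a double spike: at a point \<open>(1 - \<epsilon>) z\<close> of the shrunk curve, insert the
  loop that visits \<open>(1 - \<epsilon>) z + \<delta> u\<close> and \<open>(1 - \<epsilon>) z - \<delta> u\<close>, where \<open>u\<close> is a unit vector and
  \<open>4 \<delta> = \<epsilon> L\<close> (\<open>add_double_spike\<close>). Since the distortion is positive, some coordinate direction \<open>u\<close>
  satisfies \<open>c = E |v \<bullet> u| > 0\<close>. When \<open>Xhat\<close> lies in a suitable set of points within \<open>r\<close> of \<open>z\<close>, send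
  \<open>X\<close> to the tip on the side given by the sign of \<open>v \<bullet> u\<close>. Compared with \<open>(norm v)\<^sup>2\<close>, the new squared
  distance contains the gain \<open>- 2 \<delta> |v \<bullet> u|\<close>, an error of order \<open>r\<^sup>2 + \<delta>\<^sup>2 + \<epsilon>\<^sup>2\<close>, and a cross term
  of \<open>v\<close> with a function of \<open>Xhat\<close>, which averages to 0. This is why there are spikes on both sides:
  the gain involves \<open>|v \<bullet> u|\<close>, so it does not average to 0, and yet the set where the spikes are used
  is determined by \<open>Xhat\<close> alone, as the cancellation of the cross term requires.

  The error is harmless for \<open>r\<close> of the order of the square root of \<open>\<delta>\<close>, so this is the radius used.
  Because \<open>f\<close> has length at most \<open>L\<close>, its image is covered by \<open>1 + L / r\<close> balls of radius \<open>r\<close>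
  (\<open>variation_le_net\<close>), and the pigeonhole principle (\<open>exists_heavy_piece\<close>) gives a piece of one of
  these balls on which the expectation of \<open>|v \<bullet> u| - c / 2\<close> is at least of order \<open>r\<close>. The total gain is
  thus at least of order \<open>\<delta> r\<close>, that is \<open>\<delta>\<close> to the power \<open>3/2\<close>, which beats the cost \<open>O(\<delta>\<^sup>2)\<close> for
  small \<open>r\<close>. The new curve still has length at most \<open>L\<close>, and it is closed if \<open>f\<close> is, so the
  optimality of \<open>f\<close> is contradicted.
\<close>

section \<open>Length of curves through inscribed polygons\<close>

fun polyline_length :: "'a::real_normed_vector list \<Rightarrow> real" where
  "polyline_length [] = 0"
| "polyline_length [x] = 0"
| "polyline_length (x # y # zs) = norm (y - x) + polyline_length (y # zs)"

text \<open>
  Arbitrary sorted lists of parameters replace the subdivisions of \<open>{0..1}\<close>, whose end points are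
  prescribed: lists can be cut, concatenated and reparametrised, which makes the length of a
  concatenation of curves easy to bound. By \<open>curve_length_le_iff\<close> below nothing changes for the length.
\<close>

definition variation_le :: "(real \<Rightarrow> 'a::real_normed_vector) \<Rightarrow> real \<Rightarrow> bool" where
  "variation_le p l \<longleftrightarrow>
     (\<forall>xs. sorted xs \<longrightarrow> set xs \<subseteq> {0..1} \<longrightarrow> polyline_length (map p xs) \<le> l)"

lemma variation_leD:
  "variation_le p l \<Longrightarrow> sorted xs \<Longrightarrow> set xs \<subseteq> {0..1} \<Longrightarrow> polyline_length (map p xs) \<le> l"
  by (simp add: variation_le_def)

lemma polyline_length_split:
  "polyline_length (xs @ z # ys) = polyline_length (xs @ [z]) + polyline_length (z # ys)"
  by (induction xs rule: polyline_length.induct) auto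

lemma polyline_length_le_Cons: "polyline_length xs \<le> polyline_length (z # xs)"
  by (cases xs) auto

lemma polyline_length_le_insert:
  "polyline_length (xs @ ys) \<le> polyline_length (xs @ z # ys)"
proof (induction xs rule: polyline_length.induct)
  case 1
  then show ?case by (simp add: polyline_length_le_Cons)
next
  case (2 x)
  show ?case
  proof (cases ys)
    case (Cons y ys')
    have "norm (y - x) \<le> norm (z - x) + norm (y - z)"
      using norm_triangle_ineq[of "z - x" "y - z"] by (simp add: algebra_simps)
    then show ?thesis by (simp add: Cons)
  qed auto
qed auto

lemma polyline_length_eq_sum:
  "polyline_length (x # xs) = (\<Sum>i<length xs. norm ((x # xs) ! Suc i - (x # xs) ! i))"
proof (induction xs arbitrary: x)
  case (Cons y ys)
  then show ?case by (simp add: sum.lessThan_Suc_shift del: sum.lessThan_Suc)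
qed simp

lemma polyline_length_scaleR:
  "0 \<le> c \<Longrightarrow> polyline_length (map (\<lambda>x. c *\<^sub>R x) xs) = c * polyline_length xs"
  by (induction xs rule: polyline_length.induct)
     (auto simp: algebra_simps simp flip: scaleR_diff_right)

text \<open>
  A subdivision is a sorted list. Conversely, adding the parameters 0 and 1 to a sorted list turns
  it into a subdivision, and by the triangle inequality the inscribed polygon does not get shorter.
\<close>

lemma curve_length_le_iff:
  assumes "0 \<le> l"
  shows "curve_length f \<le> ennreal l \<longleftrightarrow> variation_le f l"
proof
  assume le: "curve_length f \<le> ennreal l"
  show "variation_le f l"
    unfolding variation_le_def
  proof (intro allI impI)
    fix xs :: "real list" assume xs: "sorted xs" "set xs \<subseteq> {0..1}"
    \<comment> \<open>the subdivision consists of 0, the entries of \<open>xs\<close>, and 1; the list \<open>ys\<close> omits the initial 0\<close>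
    define ys where "ys = xs @ [1]"
    define t where "t i = (0 # ys) ! i" for i
    have sorted: "sorted (0 # ys)"
      using xs by (auto simp: ys_def sorted_append)
    have len: "length ys \<ge> 1" by (simp add: ys_def)
    have tn: "t (length ys) = 1" by (simp add: t_def ys_def nth_append)
    have "(length ys, t) \<in> subdivisions"
      using len tn sorted_nth_mono[OF sorted, of "i - 1" i for i]
      by (auto simp: subdivisions_def t_def less_Suc_eq_le simp del: nth_Cons_pos)
    then have "(\<Sum>i=1..length ys. ennreal (norm (f (t i) - f (t (i - 1))))) \<le> curve_length f"
      unfolding curve_length_def by (rule SUP_upper2) simp
    also note le
    finally have "(\<Sum>i=1..length ys. norm (f (t i) - f (t (i - 1)))) \<le> l"
      using assms by (simp add: sum_ennreal)
    also have "(\<Sum>i=1..length ys. norm (f (t i) - f (t (i - 1))))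
        = (\<Sum>i<length ys. norm (f (t (Suc i)) - f (t i)))"
      by (simp add: sum.atLeast1_atMost_eq)
    also have "\<dots> = polyline_length (map f (0 # ys))"
      unfolding list.map polyline_length_eq_sum
      by (rule sum.cong) (auto simp: t_def nth_Cons')
    finally have "polyline_length (map f (0 # ys)) \<le> l" .
    moreover have "polyline_length (map f xs) \<le> polyline_length (map f ys)"
      using polyline_length_le_insert[of "map f xs" "[]" "f 1"] by (simp add: ys_def)
    moreover have "\<dots> \<le> polyline_length (map f (0 # ys))"
      by (simp add: polyline_length_le_Cons)
    ultimately show "polyline_length (map f xs) \<le> l" by linarith
  qed
next
  assume var: "variation_le f l"
  show "curve_length f \<le> ennreal l"
    unfolding curve_length_def
  proof (rule SUP_least, clarify)
    fix n t assume "(n, t) \<in> subdivisions"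
    then have t: "t 0 = 0" "t n = 1" and mono: "\<And>i. 1 \<le> i \<Longrightarrow> i \<le> n \<Longrightarrow> t (i - 1) \<le> t i"
      by (auto simp: subdivisions_def)
    have mono': "t i \<le> t j" if "i \<le> j" "j \<le> n" for i j
      using that
    proof (induction j)
      case (Suc j)
      then show ?case using mono[of "Suc j"] by (cases "i = Suc j") (auto intro: order_trans)
    qed auto
    define xs where "xs = map t [0..<Suc n]"
    have len: "length xs = Suc n" by (simp add: xs_def)
    have xs_nth: "xs ! i = t i" if "i \<le> n" for i
      using that by (simp add: xs_def nth_append del: upt_Suc)
    have "sorted xs"
      unfolding sorted_iff_nth_mono using mono' xs_nth len by auto
    moreover have "set xs \<subseteq> {0..1}"
      using mono'[of 0] mono'[of _ n] t by (auto simp: xs_def)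
    ultimately have "polyline_length (map f xs) \<le> l"
      by (rule variation_leD[OF var])
    moreover have "polyline_length (map f xs) = (\<Sum>i=1..n. norm (f (t i) - f (t (i - 1))))"
    proof -
      obtain a as where as: "map f xs = a # as" "length as = n"
        using len by (metis length_Suc_conv length_map)
      have nth: "(a # as) ! i = f (t i)" if "i \<le> n" for i
        using that len xs_nth by (simp flip: as(1))
      show ?thesis
        unfolding as(1) polyline_length_eq_sum as(2) sum.atLeast1_atMost_eq One_nat_def
        by (rule sum.cong) (simp_all only: nth Suc_leI less_imp_le lessThan_iff diff_Suc_Suc diff_zero)
    qed
    ultimately show "(\<Sum>i=1..n. ennreal (norm (f (t i) - f (t (i - 1))))) \<le> ennreal l"
      by (simp add: sum_ennreal ennreal_leI)
  qed
qed

text \<open>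
  A polygon inscribed in a concatenation consists of a polygon inscribed in the first curve followed
  by one inscribed in the second. All bounds on the length of a concatenation reduce to this.
\<close>

lemma joinpaths_map_sorted:
  assumes "sorted xs" "set xs \<subseteq> {0..1}"
  obtains as bs where "map (p +++ q) xs = map p as @ map q bs"
    "sorted as" "set as \<subseteq> {0..1}" "sorted bs" "set bs \<subseteq> {0..1}"
proof
  define ls rs where ls_def: "ls = takeWhile (\<lambda>x. x \<le> 1/2) xs"
    and rs_def: "rs = dropWhile (\<lambda>x. x \<le> 1/2) xs"
  have xs: "ls @ rs = xs" by (simp add: ls_def rs_def)
  have l: "x \<le> 1/2" "0 \<le> x" if "x \<in> set ls" for x
    using that assms(2) by (auto simp: ls_def dest: set_takeWhileD)
  have r: "x > 1/2" "x \<le> 1" if "x \<in> set rs" for x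
  proof -
    have s: "sorted rs" unfolding rs_def by (rule sorted_dropWhile[OF assms(1)])
    from that have ne: "rs \<noteq> []" by auto
    have "hd rs \<le> x" using s that ne by (cases rs) auto
    moreover have "\<not> hd rs \<le> 1/2" using ne unfolding rs_def by (rule hd_dropWhile)
    ultimately show "x > 1/2" by linarith
    show "x \<le> 1" using that assms(2) by (auto simp: rs_def dest: set_dropWhileD)
  qed
  have "map (p +++ q) (ls @ rs) = map p (map ((*) 2) ls) @ map q (map (\<lambda>x. 2 * x - 1) rs)"
  proof -
    have "map (p +++ q) ls = map p (map ((*) 2) ls)"
      unfolding map_map by (rule map_cong) (auto simp: joinpaths_def dest: l(1))
    moreover have "map (p +++ q) rs = map q (map (\<lambda>x. 2 * x - 1) rs)"
      unfolding map_map by (rule map_cong) (auto simp: joinpaths_def dest: r(1))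
    ultimately show ?thesis by (simp only: map_append)
  qed
  then show "map (p +++ q) xs = map p (map ((*) 2) ls) @ map q (map (\<lambda>x. 2 * x - 1) rs)"
    by (simp only: xs)
  show "sorted (map ((*) 2) ls)"
    by (rule sorted_map_mono) (auto simp: ls_def sorted_takeWhile assms(1) mono_on_def)
  show "sorted (map (\<lambda>x. 2 * x - 1) rs)"
    by (rule sorted_map_mono) (auto simp: rs_def sorted_dropWhile assms(1) mono_on_def)
  show "set (map ((*) 2) ls) \<subseteq> {0..1}"
  proof -
    have "2 * x \<in> {0..1}" if "x \<in> set ls" for x using l[OF that] by simp
    then show ?thesis by auto
  qed
  show "set (map (\<lambda>x. 2 * x - 1) rs) \<subseteq> {0..1}"
  proof -
    have "2 * x - 1 \<in> {0..1}" if "x \<in> set rs" for x using r[OF that] by simp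
    then show ?thesis by auto
  qed
qed

lemma polyline_length_append_le:
  "polyline_length (xs @ ys) \<le> polyline_length (xs @ [z]) + polyline_length (z # ys)"
  using polyline_length_le_insert[of xs ys z] by (simp only: polyline_length_split[of xs z ys])

lemma variation_le_joinpaths:
  assumes p: "variation_le p a" and q: "variation_le q b" and "pathfinish p = pathstart q"
  shows "variation_le (p +++ q) (a + b)"
  unfolding variation_le_def
proof (intro allI impI)
  fix xs :: "real list" assume "sorted xs" "set xs \<subseteq> {0..1}"
  then obtain as bs where eq: "map (p +++ q) xs = map p as @ map q bs"
    and as: "sorted as" "set as \<subseteq> {0..1}" and bs: "sorted bs" "set bs \<subseteq> {0..1}"
    by (rule joinpaths_map_sorted)
  have "polyline_length (map p (as @ [1])) \<le> a"
    using as by (intro variation_leD[OF p]) (auto simp: sorted_append)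
  moreover have "polyline_length (map q (0 # bs)) \<le> b"
    using bs by (intro variation_leD[OF q]) auto
  ultimately show "polyline_length (map (p +++ q) xs) \<le> a + b"
    using polyline_length_append_le[of "map p as" "map q bs" "p 1"] assms(3)
    by (simp add: eq pathfinish_def pathstart_def)
qed

lemma variation_le_linepath: "variation_le (linepath a b) (norm (b - a))"
  unfolding variation_le_def
proof (intro allI impI)
  fix xs :: "real list" assume xs: "sorted xs" "set xs \<subseteq> {0..1}"
  have *: "polyline_length (map (linepath a b) (x # ys)) \<le> (1 - x) * norm (b - a)"
    if "sorted (x # ys)" "set (x # ys) \<subseteq> {0..1}" for x ys
    using that
  proof (induction ys arbitrary: x)
    case (Cons y ys)
    have "linepath a b y - linepath a b x = (y - x) *\<^sub>R (b - a)"
      by (simp add: linepath_def algebra_simps)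
    then have "norm (linepath a b y - linepath a b x) = (y - x) * norm (b - a)"
      using Cons.prems by simp
    then show ?case using Cons.IH[of y] Cons.prems by (simp add: algebra_simps)
  qed auto
  show "polyline_length (map (linepath a b) xs) \<le> norm (b - a)"
  proof (cases xs)
    case (Cons x ys)
    then show ?thesis using *[of x ys] xs mult_right_mono[of "1 - x" 1 "norm (b - a)"] by force
  qed simp
qed

text \<open>
  Cutting \<open>p\<close> at \<open>t\<close> and going round the loop \<open>q\<close> costs only the length of \<open>q\<close>: the two outer parts of
  an inscribed polygon, both completed by the vertex \<open>p t\<close>, form together one polygon inscribed
  in \<open>p\<close>. Hence the length of \<open>p\<close> need not be split between its two subpaths.
\<close>

lemma variation_le_insert_loop:
  assumes p: "variation_le p a" and q: "variation_le q b" and t: "t \<in> {0..1}"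
    and "pathstart q = p t" "pathfinish q = p t"
  shows "variation_le (subpath 0 t p +++ q +++ subpath t 1 p) (a + b)"
  unfolding variation_le_def
proof (intro allI impI)
  fix xs :: "real list" assume xs: "sorted xs" "set xs \<subseteq> {0..1}"
  obtain as ys where eq1: "map (subpath 0 t p +++ q +++ subpath t 1 p) xs
      = map (subpath 0 t p) as @ map (q +++ subpath t 1 p) ys"
    and as: "sorted as" "set as \<subseteq> {0..1}" and ys: "sorted ys" "set ys \<subseteq> {0..1}"
    by (rule joinpaths_map_sorted[OF xs])
  obtain bs cs where eq2: "map (q +++ subpath t 1 p) ys = map q bs @ map (subpath t 1 p) cs"
    and bs: "sorted bs" "set bs \<subseteq> {0..1}" and cs: "sorted cs" "set cs \<subseteq> {0..1}"
    by (rule joinpaths_map_sorted[OF ys])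
  define as' cs' where "as' = map ((*) t) as" and "cs' = map (\<lambda>s. (1 - t) * s + t) cs"
  have as': "sorted as'" "set as' \<subseteq> {0..t}"
  proof -
    show "sorted as'"
      unfolding as'_def using t by (intro sorted_map_mono as) (auto simp: mono_on_def mult_left_mono)
    show "set as' \<subseteq> {0..t}"
      using as t by (auto simp: as'_def mult_left_le)
  qed
  have cs': "sorted cs'" "set cs' \<subseteq> {t..1}"
  proof -
    show "sorted cs'"
      unfolding cs'_def using t by (intro sorted_map_mono cs) (auto simp: mono_on_def mult_left_mono)
    have "(1 - t) * s \<le> 1 - t" if "s \<in> set cs" for s
      using that cs t by (intro mult_left_le) auto
    then show "set cs' \<subseteq> {t..1}"
      using cs t by (force simp: cs'_def)
  qed
  have eq: "map (subpath 0 t p +++ q +++ subpath t 1 p) xs = map p as' @ map q bs @ map p cs'"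
    unfolding eq1 eq2 by (simp add: as'_def cs'_def subpath_def)
  have "polyline_length (map p (as' @ t # cs')) \<le> a"
    using as' cs' t by (intro variation_leD[OF p]) (fastforce simp: sorted_append)+
  then have 1: "polyline_length (map p as' @ [p t]) + polyline_length (p t # map p cs') \<le> a"
    by (simp add: polyline_length_split[of _ _ "map p cs'"])
  have "polyline_length (map q (0 # bs @ [1])) \<le> b"
    using bs by (intro variation_leD[OF q]) (auto simp: sorted_append)
  then have 2: "polyline_length (p t # map q bs @ [p t]) \<le> b"
    using assms by (simp add: pathfinish_def pathstart_def)
  show "polyline_length (map (subpath 0 t p +++ q +++ subpath t 1 p) xs) \<le> a + b"
    using 1 2 polyline_length_append_le[of "map p as'" "map q bs @ map p cs'" "p t"]
      polyline_length_append_le[of "p t # map q bs" "map p cs'" "p t"]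
    by (simp add: eq)
qed

text \<open>
  The loop \<open>f t\<close>, \<open>f t + u\<close>, \<open>f t - u\<close>, \<open>f t\<close> has sides of lengths 1, 2 and 1 times the norm of \<open>u\<close>.
\<close>

lemma add_double_spike:
  fixes f :: "real \<Rightarrow> 'a::real_normed_vector"
  assumes "path f" "variation_le f l" "t \<in> {0..1}"
  obtains g where "path g" "variation_le g (l + 4 * norm u)"
    "pathstart g = pathstart f" "pathfinish g = pathfinish f"
    "path_image f \<subseteq> path_image g" "f t + u \<in> path_image g" "f t - u \<in> path_image g"
proof
  let ?z = "f t"
  let ?q = "linepath ?z (?z + u) +++ linepath (?z + u) (?z - u) +++ linepath (?z - u) ?z"
  let ?g = "subpath 0 t f +++ ?q +++ subpath t 1 f"
  have "variation_le ?q (norm u + (norm (2 *\<^sub>R u) + norm u))"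
    by (intro variation_le_joinpaths)
       (use variation_le_linepath[of ?z "?z + u"] variation_le_linepath[of "?z + u" "?z - u"]
          variation_le_linepath[of "?z - u" ?z] norm_minus_cancel[of "2 *\<^sub>R u"] in
        \<open>simp_all add: scaleR_2 del: norm_minus_cancel norm_scaleR\<close>)
  then have q: "variation_le ?q (4 * norm u)" by simp
  show "variation_le ?g (l + 4 * norm u)"
    by (rule variation_le_insert_loop[OF assms(2) q assms(3)]) auto
  show "path ?g" using assms by simp
  show "pathstart ?g = pathstart f" "pathfinish ?g = pathfinish f"
    by (simp_all add: pathstart_def pathfinish_def subpath_def joinpaths_def)
  have img: "path_image ?g = f ` {0..t} \<union> path_image ?q \<union> f ` {t..1}"
    using assms by (simp add: path_image_join path_image_subpath Un_assoc)
  have "{0..1} = {0..t} \<union> {t..1}" using assms(3) by auto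
  then show "path_image f \<subseteq> path_image ?g"
    unfolding img by (auto simp: path_image_def[of f])
  show "?z + u \<in> path_image ?g" "?z - u \<in> path_image ?g"
    unfolding img by (auto simp: path_image_join)
qed

lemma variation_le_scaleR:
  assumes "variation_le p l" "0 \<le> c"
  shows "variation_le (\<lambda>t. c *\<^sub>R p t) (c * l)"
  unfolding variation_le_def
proof (intro allI impI)
  fix xs :: "real list" assume "sorted xs" "set xs \<subseteq> {0..1}"
  then have "polyline_length (map p xs) \<le> l" by (rule variation_leD[OF assms(1)])
  then have "c * polyline_length (map p xs) \<le> c * l" using assms(2) by (rule mult_left_mono)
  then show "polyline_length (map (\<lambda>t. c *\<^sub>R p t) xs) \<le> c * l"
    using polyline_length_scaleR[OF assms(2), of "map p xs"] by (simp add: comp_def)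
qed

lemma polyline_length_separated:
  assumes "distinct xs" "\<And>x y. x \<in> set xs \<Longrightarrow> y \<in> set xs \<Longrightarrow> x \<noteq> y \<Longrightarrow> r \<le> norm (p x - p y)"
  shows "(real (length xs) - 1) * r \<le> polyline_length (map p xs) \<or> xs = []"
  using assms
proof (induction xs rule: induct_list012)
  case (3 x y zs)
  have "r \<le> norm (p y - p x)" using 3 by auto
  moreover have "(real (length (y # zs)) - 1) * r \<le> polyline_length (map p (y # zs))"
    using 3 by auto
  ultimately show ?case by (simp add: algebra_simps)
qed auto

text \<open>
  A curve of length \<open>l\<close> is covered by \<open>1 + l / r\<close> balls of radius \<open>r\<close>: the polygon through \<open>N\<close>
  points of the curve that are pairwise \<open>r\<close> apart has length at least \<open>(N - 1) r\<close>, so such a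
  family has bounded size, and one of maximal size is a net.
\<close>

lemma variation_le_net:
  assumes p: "variation_le p l" and "0 < r"
  obtains T where "finite T" "T \<subseteq> {0..1}" "real (card T) \<le> 1 + l / r"
    "\<And>s. s \<in> {0..1} \<Longrightarrow> \<exists>t\<in>T. norm (p s - p t) \<le> r"
proof -
  \<comment> \<open>the parameter sets of families of points that are pairwise \<open>r\<close> apart\<close>
  define sep where "sep T \<longleftrightarrow> finite T \<and> T \<subseteq> {0..1} \<and> 
     (\<forall>x\<in>T. \<forall>y\<in>T. x \<noteq> y \<longrightarrow> r \<le> norm (p x - p y))" for T
  have l: "0 \<le> l" using variation_leD[OF p, of "[]"] by simp
  have card: "real (card T) \<le> 1 + l / r" if "sep T" for T
  proof -
    let ?xs = "sorted_list_of_set T"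
    have fin: "finite T" and T: "T \<subseteq> {0..1}" using that by (auto simp: sep_def)
    have "polyline_length (map p ?xs) \<le> l"
      using fin T by (intro variation_leD[OF p]) auto
    moreover have "(real (length ?xs) - 1) * r \<le> polyline_length (map p ?xs) \<or> ?xs = []"
      using that by (intro polyline_length_separated) (auto simp: sep_def)
    ultimately have "(real (card T) - 1) * r \<le> l \<or> T = {}"
      using fin by auto
    then show ?thesis using \<open>0 < r\<close> l by (auto simp: field_simps)
  qed
  have "sep {}" by (simp add: sep_def)
  moreover have "\<forall>T. sep T \<longrightarrow> card T < Suc (nat \<lceil>1 + l / r\<rceil>)"
  proof (intro allI impI)
    fix T assume "sep T"
    then have "real (card T) \<le> 1 + l / r" by (rule card)
    also have "\<dots> \<le> real (nat \<lceil>1 + l / r\<rceil>)" by (rule real_nat_ceiling_ge)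
    finally show "card T < Suc (nat \<lceil>1 + l / r\<rceil>)" by simp
  qed
  ultimately obtain T where T: "sep T" "\<And>S. sep S \<Longrightarrow> card S \<le> card T"
    using ex_has_greatest_nat[of sep "{}" card] by metis
  show thesis
  proof
    show "finite T" "T \<subseteq> {0..1}" using T(1) by (auto simp: sep_def)
    show "real (card T) \<le> 1 + l / r" by (rule card[OF T(1)])
    show "\<exists>t\<in>T. norm (p s - p t) \<le> r" if s: "s \<in> {0..1}" for s
    proof (rule ccontr)
      assume "\<not> ?thesis"
      then have far: "\<forall>t\<in>T. r < norm (p s - p t)" by auto
      with \<open>0 < r\<close> have "s \<notin> T" by force
      moreover have "sep (insert s T)"
        using T(1) far s by (auto simp: sep_def norm_minus_commute less_imp_le)
      ultimately show False
        using T(2)[of "insert s T"] T(1) by (simp add: sep_def)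
    qed
  qed
qed

section \<open>Effect of spikes and of shrinking on squared distances\<close>

text \<open>
  The point \<open>y\<close> is replaced by the tip of one of the two spikes at \<open>(1 - \<epsilon>) z\<close>, on the side of
  \<open>x\<close>. Expanding the square at \<open>v = x - y\<close> produces the gain \<open>- 2 \<delta> |v \<bullet> u|\<close>, a cross term of \<open>v\<close> with a
  displacement independent of \<open>x\<close>, and the squared norm of the total displacement, a
  sum of three vectors of norms at most \<open>\<epsilon> R\<close>, \<open>r\<close> and \<open>\<delta>\<close>. The assumption on \<open>\<delta>\<close> and \<open>c\<close> lets \<open>\<delta> c\<close>
  absorb the terms in \<open>r\<close> and \<open>\<delta>\<close>.
\<close>

lemma spike_square_bound:
  fixes x y z u :: "'a::real_inner"
  assumes "norm u = 1" "norm y \<le> R" "norm (y - z) \<le> r" "0 \<le> \<epsilon>" "\<epsilon> \<le> 1"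
    and \<delta>: "0 \<le> \<delta>" "3 * (r\<^sup>2 + \<delta>\<^sup>2) \<le> \<delta> * c"
    and s: "s = (if 0 \<le> (x - y) \<bullet> u then 1 else -1)"
  shows "(norm (x - ((1 - \<epsilon>) *\<^sub>R z + (s * \<delta>) *\<^sub>R u)))\<^sup>2
    \<le> (norm (x - y))\<^sup>2 + 2 * ((x - y) \<bullet> (y - (1 - \<epsilon>) *\<^sub>R z)) + 3 * \<epsilon>\<^sup>2 * R\<^sup>2
       - 2 * \<delta> * (\<bar>(x - y) \<bullet> u\<bar> - c / 2)"
proof -
  define v where "v = x - y"
  define w where "w = y - (1 - \<epsilon>) *\<^sub>R z"
  have "(norm (x - ((1 - \<epsilon>) *\<^sub>R z + (s * \<delta>) *\<^sub>R u)))\<^sup>2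
      = (norm (v + (w - (s * \<delta>) *\<^sub>R u)))\<^sup>2"
    by (simp add: v_def w_def algebra_simps)
  also have "\<dots> = (norm v)\<^sup>2 + 2 * (v \<bullet> w) - 2 * \<delta> * (s * (v \<bullet> u))
      + (norm (w - (s * \<delta>) *\<^sub>R u))\<^sup>2"
    by (simp add: power2_norm_eq_inner inner_simps inner_commute algebra_simps)
  also have "s * (v \<bullet> u) = \<bar>v \<bullet> u\<bar>"
    using s by (auto simp: v_def)
  finally have eq: "(norm (x - ((1 - \<epsilon>) *\<^sub>R z + (s * \<delta>) *\<^sub>R u)))\<^sup>2
      = (norm v)\<^sup>2 + 2 * (v \<bullet> w) - 2 * \<delta> * \<bar>v \<bullet> u\<bar> + (norm (w - (s * \<delta>) *\<^sub>R u))\<^sup>2" .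
  have "norm (w - (s * \<delta>) *\<^sub>R u) = norm ((\<epsilon> *\<^sub>R y + (1 - \<epsilon>) *\<^sub>R (y - z)) - (s * \<delta>) *\<^sub>R u)"
    by (simp add: w_def algebra_simps)
  also have "\<dots> \<le> norm (\<epsilon> *\<^sub>R y) + norm ((1 - \<epsilon>) *\<^sub>R (y - z)) + norm ((s * \<delta>) *\<^sub>R u)"
    by (intro order_trans[OF norm_triangle_ineq4] add_right_mono norm_triangle_ineq)
  also have "\<dots> \<le> \<epsilon> * R + r + \<delta>"
  proof (intro add_mono)
    show "norm (\<epsilon> *\<^sub>R y) \<le> \<epsilon> * R" using assms by (simp add: mult_left_mono)
    have "(1 - \<epsilon>) * norm (y - z) \<le> 1 * r" using assms by (intro mult_mono) auto
    then show "norm ((1 - \<epsilon>) *\<^sub>R (y - z)) \<le> r" using assms by simp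
    show "norm ((s * \<delta>) *\<^sub>R u) \<le> \<delta>" using assms by (simp add: abs_mult)
  qed
  finally have "(norm (w - (s * \<delta>) *\<^sub>R u))\<^sup>2 \<le> (\<epsilon> * R + r + \<delta>)\<^sup>2"
    by (intro power_mono) auto
  also have "\<dots> \<le> 3 * ((\<epsilon> * R)\<^sup>2 + r\<^sup>2 + \<delta>\<^sup>2)"
    using sum_squares_ge_zero[of "\<epsilon> * R - r" "r - \<delta>"] zero_le_power2[of "\<epsilon> * R - \<delta>"]
    by (simp add: power2_eq_square algebra_simps)
  also have "\<dots> \<le> 3 * \<epsilon>\<^sup>2 * R\<^sup>2 + \<delta> * c"
    using \<delta>(2) by (simp add: power_mult_distrib algebra_simps)
  finally show ?thesis
    unfolding eq by (simp add: v_def w_def algebra_simps)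
qed

text \<open>
  The counterpart for the points of the curve away from the spikes; the factor 3 gives the
  same error term as in \<open>spike_square_bound\<close>.
\<close>

lemma shrink_square_bound:
  fixes x y :: "'a::real_inner"
  assumes "norm y \<le> R"
  shows "(norm (x - (1 - \<epsilon>) *\<^sub>R y))\<^sup>2
    \<le> (norm (x - y))\<^sup>2 + 2 * ((x - y) \<bullet> (\<epsilon> *\<^sub>R y)) + 3 * \<epsilon>\<^sup>2 * R\<^sup>2"
proof -
  have "(norm (x - (1 - \<epsilon>) *\<^sub>R y))\<^sup>2 = (norm ((x - y) + \<epsilon> *\<^sub>R y))\<^sup>2"
    by (simp add: algebra_simps)
  also have "\<dots> = (norm (x - y))\<^sup>2 + 2 * ((x - y) \<bullet> (\<epsilon> *\<^sub>R y)) + \<epsilon>\<^sup>2 * (norm y)\<^sup>2"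
    by (simp only: power2_norm_eq_inner)
      (simp add: inner_simps inner_commute algebra_simps power2_eq_square)
  also have "\<epsilon>\<^sup>2 * (norm y)\<^sup>2 \<le> \<epsilon>\<^sup>2 * R\<^sup>2"
    using assms by (intro mult_left_mono power_mono) auto
  also have "\<dots> \<le> 3 * \<epsilon>\<^sup>2 * R\<^sup>2" by simp
  finally show ?thesis by simp
qed

section \<open>Pieces of the curve that carry much mass\<close>

text \<open>
  Pigeonhole principle for the signed density \<open>g\<close>: if every Borel part of each ball had
  \<open>g\<close>-mass at most \<open>K\<close>, then peeling off the balls one at a time would bound the total mass
  by \<open>card T * K\<close>. Parts of balls are needed because the balls overlap and \<open>g\<close> changes sign.
\<close>

lemma exists_heavy_piece:
  fixes Y :: "'w \<Rightarrow> 'a::euclidean_space" and g :: "'w \<Rightarrow> real"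
  assumes g: "integrable M g" and Y[measurable]: "Y \<in> borel_measurable M" and "finite T"
    and cover: "\<And>\<omega>. \<omega> \<in> space M \<Longrightarrow> \<exists>t\<in>T. norm (Y \<omega> - p t) \<le> r"
    and K: "real (card T) * K < (\<integral>\<omega>. g \<omega> \<partial>M)"
  obtains t B where "t \<in> T" "B \<in> sets borel" "B \<subseteq> cball (p t) r"
    "K < (\<integral>\<omega>. indicator B (Y \<omega>) * g \<omega> \<partial>M)"
proof -
  define \<phi> where "\<phi> S = (\<integral>\<omega>. indicator S (Y \<omega>) * g \<omega> \<partial>M)" for S
  have int: "integrable M (\<lambda>\<omega>. indicator S (Y \<omega>) * g \<omega>)" if [measurable]: "S \<in> sets borel" for S
    by (rule Bochner_Integration.integrable_bound[OF g])
       (use borel_measurable_integrable[OF g] in \<open>auto simp: indicator_def\<close>)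
  have bound: "\<phi> S \<le> real (card T') * K"
    if "finite T'" "S \<in> sets borel" "S \<subseteq> (\<Union>t\<in>T'. cball (p t) r)"
      "\<And>t B. t \<in> T' \<Longrightarrow> B \<in> sets borel \<Longrightarrow> B \<subseteq> cball (p t) r \<Longrightarrow> \<phi> B \<le> K" for T' S
    using that
  proof (induction T' arbitrary: S rule: finite_induct)
    case empty
    then have "S = {}" by auto
    then show ?case by (simp add: \<phi>_def)
  next
    case (insert t T')
    let ?A = "S \<inter> cball (p t) r" and ?C = "S - cball (p t) r"
    have meas: "?A \<in> sets borel" "?C \<in> sets borel" using insert.prems by auto
    have "indicator S (Y \<omega>) * g \<omega> = indicator ?A (Y \<omega>) * g \<omega> + indicator ?C (Y \<omega>) * g \<omega>" for \<omega>
      by (auto simp: indicator_def)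
    then have "\<phi> S = \<phi> ?A + \<phi> ?C"
      using int meas by (simp add: \<phi>_def)
    moreover have "\<phi> ?A \<le> K" using insert.prems meas by blast
    moreover have "\<phi> ?C \<le> real (card T') * K"
      using insert.prems meas by (intro insert.IH) auto
    ultimately show ?case using insert.hyps by (simp add: algebra_simps)
  qed
  note heavy = that
  show thesis
  proof (rule ccontr)
    assume no: "\<not> thesis"
    have small: "\<phi> B \<le> K" if "t \<in> T" "B \<in> sets borel" "B \<subseteq> cball (p t) r" for t B
      using no heavy[OF that] unfolding \<phi>_def by linarith
    let ?S = "\<Union>t\<in>T. cball (p t) r"
    have "?S \<in> sets borel" using \<open>finite T\<close> by auto
    then have "\<phi> ?S \<le> real (card T) * K" using \<open>finite T\<close> small by (intro bound) auto
    moreover have "\<phi> ?S = (\<integral>\<omega>. g \<omega> \<partial>M)"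
      unfolding \<phi>_def using cover
      by (intro Bochner_Integration.integral_cong)
         (auto simp: indicator_def dist_norm norm_minus_commute)
    ultimately show False using K by simp
  qed
qed

section \<open>Orthogonality of the residual\<close>

lemma (in prob_space) integrable_quadratic_bound:
  fixes X :: "'a \<Rightarrow> 'b::euclidean_space" and g :: "'a \<Rightarrow> real"
  assumes "integrable M (\<lambda>\<omega>. (norm (X \<omega>))\<^sup>2)" "g \<in> borel_measurable M"
    and "\<And>\<omega>. \<omega> \<in> space M \<Longrightarrow> \<bar>g \<omega>\<bar> \<le> a * (1 + (norm (X \<omega>))\<^sup>2)"
  shows "integrable M g"
proof (rule Bochner_Integration.integrable_bound)
  show "integrable M (\<lambda>\<omega>. a * (1 + (norm (X \<omega>))\<^sup>2))" using assms(1) by simp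
  show "AE \<omega> in M. norm (g \<omega>) \<le> norm (a * (1 + (norm (X \<omega>))\<^sup>2))"
    using assms(3) by (intro AE_I2) (force intro: order_trans)
qed (fact assms(2))

lemma borel_measurable_vec_nth [measurable (raw)]:
  fixes Y :: "'w \<Rightarrow> real ^ 'd"
  assumes "Y \<in> borel_measurable M"
  shows "(\<lambda>\<omega>. Y \<omega> $ i) \<in> borel_measurable M"
  using borel_measurable_inner[OF assms borel_measurable_const[of "axis i 1"]]
  by (simp add: inner_axis)

text \<open>
  If \<open>E[X | Y] = Y\<close>, the residual \<open>X - Y\<close> is orthogonal to bounded functions of \<open>Y\<close>. The conditional
  expectation being coordinatewise, this is the characteristic property of the real-valued one,
  applied to each coordinate and summed.
\<close>

lemma (in prob_space) residual_orthogonal: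
  fixes X Y :: "'a \<Rightarrow> real ^ 'd" and h :: "real ^ 'd \<Rightarrow> real ^ 'd"
  assumes X[measurable]: "X \<in> borel_measurable M"
    and X2: "integrable M (\<lambda>\<omega>. (norm (X \<omega>))\<^sup>2)"
    and Y[measurable]: "Y \<in> borel_measurable M"
    and Y_bound: "\<And>\<omega>. \<omega> \<in> space M \<Longrightarrow> norm (Y \<omega>) \<le> R"
    and ce: "AE \<omega> in M. cond_exp_given M X Y \<omega> = Y \<omega>"
    and h[measurable]: "h \<in> borel_measurable borel"
    and h_bound: "\<And>\<omega>. \<omega> \<in> space M \<Longrightarrow> norm (h (Y \<omega>)) \<le> K"
  shows "integrable M (\<lambda>\<omega>. (X \<omega> - Y \<omega>) \<bullet> h (Y \<omega>))"
    and "(\<integral>\<omega>. (X \<omega> - Y \<omega>) \<bullet> h (Y \<omega>) \<partial>M) = 0"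
proof -
  let ?F = "vimage_algebra (space M) Y borel"
  have "subalgebra M ?F"
    unfolding subalgebra_def using sets_image_in_sets[OF refl Y] by simp
  then interpret finite_measure_subalgebra M ?F
    by unfold_locales
  have YF: "Y \<in> borel_measurable ?F" by (rule measurable_vimage_algebra1) auto
  have coord: "integrable M (\<lambda>\<omega>. h (Y \<omega>) $ i * (X \<omega> - Y \<omega>) $ i) \<and>
      (\<integral>\<omega>. h (Y \<omega>) $ i * (X \<omega> - Y \<omega>) $ i \<partial>M) = 0" for i
  proof -
    have hF: "(\<lambda>\<omega>. h (Y \<omega>) $ i) \<in> borel_measurable ?F"
      by (rule measurable_compose[OF YF]) measurable
    have hi: "\<bar>h (Y \<omega>) $ i\<bar> \<le> K" if "\<omega> \<in> space M" for \<omega>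
      using component_le_norm_cart[of "h (Y \<omega>)" i] h_bound[OF that] by simp
    have intX: "integrable M (\<lambda>\<omega>. h (Y \<omega>) $ i * X \<omega> $ i)"
    proof (rule integrable_quadratic_bound[OF X2])
      fix \<omega> assume \<omega>: "\<omega> \<in> space M"
      have "\<bar>X \<omega> $ i\<bar> \<le> norm (X \<omega>)" by (rule component_le_norm_cart)
      also have "\<dots> \<le> 1 + (norm (X \<omega>))\<^sup>2"
        using zero_le_power2[of "norm (X \<omega>) - 1 / 2"] by (simp add: power2_eq_square algebra_simps)
      finally show "\<bar>h (Y \<omega>) $ i * X \<omega> $ i\<bar> \<le> K * (1 + (norm (X \<omega>))\<^sup>2)"
        unfolding abs_mult using hi[OF \<omega>] by (intro mult_mono) auto
    qed measurable
    have intY: "integrable M (\<lambda>\<omega>. h (Y \<omega>) $ i * Y \<omega> $ i)"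
    proof (rule integrable_const_bound[where B = "K * R"])
      have "\<bar>h (Y \<omega>) $ i * Y \<omega> $ i\<bar> \<le> K * R" if "\<omega> \<in> space M" for \<omega>
        unfolding abs_mult using hi[OF that] component_le_norm_cart[of "Y \<omega>" i] Y_bound[OF that]
        by (intro mult_mono) auto
      then show "AE \<omega> in M. norm (h (Y \<omega>) $ i * Y \<omega> $ i) \<le> K * R" by auto
    qed measurable
    have "(\<integral>\<omega>. h (Y \<omega>) $ i * X \<omega> $ i \<partial>M)
        = (\<integral>\<omega>. h (Y \<omega>) $ i * real_cond_exp M ?F (\<lambda>\<omega>'. X \<omega>' $ i) \<omega> \<partial>M)"
      by (rule real_cond_exp_intg(2)[OF intX hF, symmetric]) measurable
    also have "\<dots> = (\<integral>\<omega>. h (Y \<omega>) $ i * Y \<omega> $ i \<partial>M)"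
    proof (rule integral_cong_AE)
      show "AE \<omega> in M. h (Y \<omega>) $ i * real_cond_exp M ?F (\<lambda>\<omega>'. X \<omega>' $ i) \<omega> = h (Y \<omega>) $ i * Y \<omega> $ i"
        using ce by eventually_elim (auto simp: cond_exp_given_def vec_eq_iff)
    qed measurable
    finally show ?thesis using intX intY by (simp add: algebra_simps)
  qed
  have eq: "(\<lambda>\<omega>. (X \<omega> - Y \<omega>) \<bullet> h (Y \<omega>)) = (\<lambda>\<omega>. \<Sum>i\<in>UNIV. h (Y \<omega>) $ i * (X \<omega> - Y \<omega>) $ i)"
    by (simp add: inner_vec_def mult.commute)
  show "integrable M (\<lambda>\<omega>. (X \<omega> - Y \<omega>) \<bullet> h (Y \<omega>))"
    unfolding eq using coord by auto
  show "(\<integral>\<omega>. (X \<omega> - Y \<omega>) \<bullet> h (Y \<omega>) \<partial>M) = 0"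
    unfolding eq using coord by (subst Bochner_Integration.integral_sum) auto
qed

section \<open>Improving a self-consistent curve\<close>

text \<open>
  With \<open>\<delta> = 6 r\<^sup>2 / c\<close> and \<open>\<epsilon> = 4 \<delta> / L\<close>, the three upper bounds on \<open>r\<close> say in this order that \<open>\<delta> \<le> r\<close>, that
  \<open>\<epsilon> \<le> 1\<close>, and that the gain from the spikes outweighs the cost of shrinking.
\<close>

lemma small_radius:
  fixes c L R :: real
  assumes "0 < c" "0 < L"
  obtains r where "0 < r" "6 * r \<le> c" "24 * r\<^sup>2 \<le> c * L"
    "576 * R\<^sup>2 * (r\<^sup>2 + L * r) \<le> c\<^sup>2 * L\<^sup>2"
proof -
  have "\<forall>\<^sub>F r in at_right 0. 6 * r < c"
    by (rule order_tendstoD(2)[of _ "6 * 0"]) (intro tendsto_intros, use assms in simp)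
  moreover have "\<forall>\<^sub>F r in at_right 0. 24 * r\<^sup>2 < c * L"
    by (rule order_tendstoD(2)[of _ "24 * 0\<^sup>2"]) (intro tendsto_intros, use assms in simp)
  moreover have "\<forall>\<^sub>F r in at_right 0. 576 * R\<^sup>2 * (r\<^sup>2 + L * r) < c\<^sup>2 * L\<^sup>2"
    by (rule order_tendstoD(2)[of _ "576 * R\<^sup>2 * (0\<^sup>2 + L * 0)"])
       (intro tendsto_intros, use assms in simp)
  moreover have "\<forall>\<^sub>F r in at_right 0. 0 < (r::real)"
    by (rule eventually_at_right_less)
  ultimately have "\<forall>\<^sub>F r in at_right 0. 0 < r \<and> 6 * r < c \<and> 24 * r\<^sup>2 < c * L \<and>
      576 * R\<^sup>2 * (r\<^sup>2 + L * r) < c\<^sup>2 * L\<^sup>2"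
    by eventually_elim auto
  then obtain r where "0 < r \<and> 6 * r < c \<and> 24 * r\<^sup>2 < c * L \<and>
      576 * R\<^sup>2 * (r\<^sup>2 + L * r) < c\<^sup>2 * L\<^sup>2"
    using eventually_happens'[OF trivial_limit_at_right_real] by blast
  then show thesis by (intro that[of r]) auto
qed


theorem lemma3p2:
  fixes M :: "'w measure"
    and X Xhat :: "'w \<Rightarrow> real ^ 'd"
    and C :: "real \<Rightarrow> (real \<Rightarrow> real ^ 'd) set"
    and L :: real
    and f :: "real \<Rightarrow> real ^ 'd"
  assumes "prob_space M"
    and "X \<in> borel_measurable M"
    and "integrable M (\<lambda>\<omega>. (norm (X \<omega>))\<^sup>2)"
    and "C = open_curves \<or> C = closed_curves"
    and "L > 0"
    and "min_distortion M X (C L) > 0"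
    and "f \<in> C L"
    and "distortion M X f = min_distortion M X (C L)"
    and "Xhat \<in> borel_measurable M"
    and "\<forall>\<omega>\<in>space M. Xhat \<omega> \<in> path_image f"
    and "AE \<omega> in M. norm (X \<omega> - Xhat \<omega>) = infdist (X \<omega>) (path_image f)"
  shows "measure M {\<omega> \<in> space M. cond_exp_given M X Xhat \<omega> \<noteq> Xhat \<omega>} > 0"
proof (rule ccontr)
  assume not_pos: "\<not> ?thesis"
  interpret prob_space M by (rule assms(1))
  note X[measurable] = assms(2) and Xhat[measurable] = assms(9)
  note X2 = assms(3) and L = \<open>L > 0\<close>
  have path: "path f" and len: "variation_le f L"
    using assms(4,7) L by (auto simp: open_curves_def closed_curves_def curve_length_le_iff)

  let ?F = "vimage_algebra (space M) Xhat borel"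
  have "subalgebra M ?F"
    unfolding subalgebra_def using sets_image_in_sets[OF refl Xhat] by simp
  then have [measurable]: "real_cond_exp M ?F (\<lambda>\<omega>'. X \<omega>' $ i) \<in> borel_measurable M" for i
    by (rule measurable_from_subalg) simp
  have "{\<omega> \<in> space M. cond_exp_given M X Xhat \<omega> \<noteq> Xhat \<omega>}
      = (\<Union>i. {\<omega> \<in> space M. real_cond_exp M ?F (\<lambda>\<omega>'. X \<omega>' $ i) \<omega> \<noteq> Xhat \<omega> $ i})"
    by (auto simp: cond_exp_given_def vec_eq_iff)
  also have "\<dots> \<in> sets M" by (rule sets.finite_UN) (simp, measurable)
  finally have "{\<omega> \<in> space M. cond_exp_given M X Xhat \<omega> \<noteq> Xhat \<omega>} \<in> null_sets M"
    using not_pos by (auto simp: null_sets_def emeasure_eq_measure not_less measure_le_0_iff)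
  then have ce: "AE \<omega> in M. cond_exp_given M X Xhat \<omega> = Xhat \<omega>"
    by (rule AE_I') auto

  obtain R where R: "\<And>x. x \<in> path_image f \<Longrightarrow> norm x \<le> R"
    using bounded_path_image[OF path] by (auto simp: bounded_iff)
  then have Xhat_bound: "norm (Xhat \<omega>) \<le> R" if "\<omega> \<in> space M" for \<omega>
    using assms(10) that by auto
  have "R \<ge> 0" using Xhat_bound not_empty norm_ge_zero order_trans by blast

  let ?D = "\<integral>\<omega>. (norm (X \<omega> - Xhat \<omega>))\<^sup>2 \<partial>M"
  have D: "distortion M X f = ?D"
    unfolding distortion_def
  proof (rule integral_cong_AE)
    show "AE \<omega> in M. (infdist (X \<omega>) (path_image f))\<^sup>2 = (norm (X \<omega> - Xhat \<omega>))\<^sup>2"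
      using assms(11) by eventually_elim simp
    have "(\<lambda>x. infdist x (path_image f)) \<in> borel_measurable borel"
      by (intro borel_measurable_continuous_onI continuous_intros)
    then show "(\<lambda>\<omega>. (infdist (X \<omega>) (path_image f))\<^sup>2) \<in> borel_measurable M"
      by measurable
  qed measurable
  have "?D > 0" using assms(6,8) D by simp
  have v_bound: "(norm (X \<omega> - Xhat \<omega>))\<^sup>2 \<le> (2 + 2 * R\<^sup>2) * (1 + (norm (X \<omega>))\<^sup>2)"
    if "\<omega> \<in> space M" for \<omega>
  proof -
    have "norm (X \<omega> - Xhat \<omega>) \<le> norm (X \<omega>) + R"
      using norm_triangle_ineq4[of "X \<omega>" "Xhat \<omega>"] Xhat_bound[OF that] by linarith
    then have "(norm (X \<omega> - Xhat \<omega>))\<^sup>2 \<le> (norm (X \<omega>) + R)\<^sup>2"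
      by (intro power_mono) auto
    also have "\<dots> \<le> 2 * (norm (X \<omega>))\<^sup>2 + 2 * R\<^sup>2"
      using zero_le_power2[of "norm (X \<omega>) - R"] by (simp add: power2_eq_square algebra_simps)
    also have "\<dots> \<le> (2 + 2 * R\<^sup>2) * (1 + (norm (X \<omega>))\<^sup>2)"
      by (simp add: algebra_simps)
    finally show ?thesis .
  qed
  have int_v2: "integrable M (\<lambda>\<omega>. (norm (X \<omega> - Xhat \<omega>))\<^sup>2)"
    by (rule integrable_quadratic_bound[OF X2]) (use v_bound in auto)
  have int_vu: "integrable M (\<lambda>\<omega>. \<bar>(X \<omega> - Xhat \<omega>) \<bullet> b\<bar>)" if "b \<in> Basis" for b
  proof (rule integrable_quadratic_bound[OF int_v2])
    show "\<bar>\<bar>(X \<omega> - Xhat \<omega>) \<bullet> b\<bar>\<bar> \<le> 1 * (1 + (norm (X \<omega> - Xhat \<omega>))\<^sup>2)" for \<omega>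
      using Basis_le_norm[OF that, of "X \<omega> - Xhat \<omega>"]
        zero_le_power2[of "norm (X \<omega> - Xhat \<omega>) - 1"] by (simp add: power2_eq_square algebra_simps)
  qed measurable
  have "\<exists>u\<in>Basis. 0 < (\<integral>\<omega>. \<bar>(X \<omega> - Xhat \<omega>) \<bullet> u\<bar> \<partial>M)"
  proof (rule ccontr)
    assume none: "\<not> ?thesis"
    have "AE \<omega> in M. (X \<omega> - Xhat \<omega>) \<bullet> b = 0" if b: "b \<in> Basis" for b
    proof -
      have "(\<integral>\<omega>. \<bar>(X \<omega> - Xhat \<omega>) \<bullet> b\<bar> \<partial>M) = 0"
        using none b by (intro antisym Bochner_Integration.integral_nonneg) (auto simp: not_less)
      then show ?thesis
        using integral_nonneg_eq_0_iff_AE[OF int_vu[OF b]] by auto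
    qed
    then have "AE \<omega> in M. \<forall>b\<in>Basis. (X \<omega> - Xhat \<omega>) \<bullet> b = 0"
      by (intro AE_finite_allI) auto
    then have "AE \<omega> in M. (norm (X \<omega> - Xhat \<omega>))\<^sup>2 = 0"
      by eventually_elim (simp add: euclidean_all_zero_iff)
    then have "?D = 0" by (rule integral_eq_zero_AE)
    with \<open>?D > 0\<close> show False by simp
  qed
  then obtain u :: "real ^ 'd" where u: "u \<in> Basis"
    and c_pos: "0 < (\<integral>\<omega>. \<bar>(X \<omega> - Xhat \<omega>) \<bullet> u\<bar> \<partial>M)"
    by blast
  define c where "c = (\<integral>\<omega>. \<bar>(X \<omega> - Xhat \<omega>) \<bullet> u\<bar> \<partial>M)"
  have c: "0 < c" using c_pos by (simp add: c_def)

  obtain r where r: "0 < r" "6 * r \<le> c" "24 * r\<^sup>2 \<le> c * L"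
      "576 * R\<^sup>2 * (r\<^sup>2 + L * r) \<le> c\<^sup>2 * L\<^sup>2"
    by (rule small_radius[OF c L])
  \<comment> \<open>\<open>\<delta> c = 6 r\<^sup>2\<close> makes the error \<open>3 (r\<^sup>2 + \<delta>\<^sup>2)\<close> of a spike at most \<open>\<delta> c\<close>; the loop of
    length \<open>4 \<delta>\<close> uses up exactly the length \<open>\<epsilon> L\<close> freed by shrinking; and \<open>K\<close> is chosen
    so that \<open>1 + L / r\<close> pieces of mass at most \<open>K\<close> amount to \<open>c / 4\<close>, less than the total mass \<open>c / 2\<close>\<close>
  define \<delta> where "\<delta> = 6 * r\<^sup>2 / c"
  define \<epsilon> where "\<epsilon> = 4 * \<delta> / L"
  define K where "K = c / (4 * (1 + L / r))"
  have \<delta>: "0 < \<delta>" using r c by (simp add: \<delta>_def)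
  have "\<delta> \<le> r"
    using mult_right_mono[OF r(2), of r] r(1) c by (simp add: \<delta>_def field_simps power2_eq_square)
  have spike: "3 * (r\<^sup>2 + \<delta>\<^sup>2) \<le> \<delta> * c"
  proof -
    have "\<delta>\<^sup>2 \<le> r\<^sup>2" using \<delta> \<open>\<delta> \<le> r\<close> by (intro power_mono) auto
    moreover have "\<delta> * c = 6 * r\<^sup>2" using c by (simp add: \<delta>_def)
    ultimately show ?thesis by simp
  qed
  have \<epsilon>: "0 \<le> \<epsilon>" "\<epsilon> \<le> 1"
    using r c L by (simp_all add: \<epsilon>_def \<delta>_def field_simps)
  have budget: "3 * \<epsilon>\<^sup>2 * R\<^sup>2 \<le> 2 * \<delta> * K"
  proof -
    have "96 * R\<^sup>2 * \<delta> * (1 + L / r) * c = 576 * R\<^sup>2 * (r\<^sup>2 + L * r)"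
      using r(1) c by (simp add: \<delta>_def field_simps power2_eq_square)
    also have "\<dots> \<le> c\<^sup>2 * L\<^sup>2" by (rule r(4))
    finally have "96 * R\<^sup>2 * \<delta> * (1 + L / r) \<le> c * L\<^sup>2"
      using c by (simp add: power2_eq_square)
    then have "48 * R\<^sup>2 * \<delta> / L\<^sup>2 \<le> 2 * K"
      using r(1) L by (simp add: K_def field_simps add_pos_pos)
    then have "\<delta> * (48 * R\<^sup>2 * \<delta> / L\<^sup>2) \<le> \<delta> * (2 * K)"
      using \<delta> by (intro mult_left_mono) auto
    then show ?thesis by (simp add: \<epsilon>_def power2_eq_square algebra_simps)
  qed

  obtain T where T: "finite T" "T \<subseteq> {0..1}" "real (card T) \<le> 1 + L / r"
      and net: "\<And>s. s \<in> {0..1} \<Longrightarrow> \<exists>t\<in>T. norm (f s - f t) \<le> r"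
    using variation_le_net[OF len r(1)] by metis
  define g where "g \<omega> = \<bar>(X \<omega> - Xhat \<omega>) \<bullet> u\<bar> - c / 2" for \<omega>
  have int_g: "integrable M g" unfolding g_def using int_vu[OF u] by simp
  have "(\<integral>\<omega>. g \<omega> \<partial>M) = c / 2"
    unfolding g_def using int_vu[OF u] by (simp add: c_def prob_space)
  moreover have "real (card T) * K \<le> c / 4"
  proof -
    have "0 < 1 + L / r" using r L by (simp add: add_pos_pos)
    have "real (card T) * K \<le> (1 + L / r) * K"
      using T(3) c \<open>0 < 1 + L / r\<close> by (intro mult_right_mono) (simp_all add: K_def)
    also have "\<dots> = c / 4"
    proof -
      have "x * (c / (4 * x)) = c / 4" if "0 < x" for x
        using that by simp
      then show ?thesis unfolding K_def using \<open>0 < 1 + L / r\<close> .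
    qed
    finally show ?thesis .
  qed
  ultimately have K_less: "real (card T) * K < (\<integral>\<omega>. g \<omega> \<partial>M)" using c by simp
  have cover: "\<exists>t\<in>T. norm (Xhat \<omega> - f t) \<le> r" if "\<omega> \<in> space M" for \<omega>
    using assms(10) that net by (auto simp: path_image_def)
  obtain t B where t: "t \<in> T" and B[measurable]: "B \<in> sets borel"
    and B_ball: "B \<subseteq> cball (f t) r" and heavy: "K < (\<integral>\<omega>. indicator B (Xhat \<omega>) * g \<omega> \<partial>M)"
    by (rule exists_heavy_piece[OF int_g Xhat T(1) cover K_less])
  have t01: "t \<in> {0..1}" using t T by auto
  define z where "z = f t"

  have "path (\<lambda>s. (1 - \<epsilon>) *\<^sub>R f s)"
    using path unfolding path_def by (intro continuous_intros)
  moreover have "variation_le (\<lambda>s. (1 - \<epsilon>) *\<^sub>R f s) ((1 - \<epsilon>) * L)"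
    using \<epsilon> by (intro variation_le_scaleR len) auto
  ultimately obtain k where k: "path k" "variation_le k ((1 - \<epsilon>) * L + 4 * norm (\<delta> *\<^sub>R u))"
      "pathstart k = (1 - \<epsilon>) *\<^sub>R f 0" "pathfinish k = (1 - \<epsilon>) *\<^sub>R f 1"
    and k_image: "path_image (\<lambda>s. (1 - \<epsilon>) *\<^sub>R f s) \<subseteq> path_image k"
      "(1 - \<epsilon>) *\<^sub>R z + \<delta> *\<^sub>R u \<in> path_image k" "(1 - \<epsilon>) *\<^sub>R z - \<delta> *\<^sub>R u \<in> path_image k"
    using add_double_spike[of "\<lambda>s. (1 - \<epsilon>) *\<^sub>R f s" "(1 - \<epsilon>) * L" t "\<delta> *\<^sub>R u"] t01
    by (auto simp: z_def pathstart_def pathfinish_def)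
  have "(1 - \<epsilon>) * L + 4 * norm (\<delta> *\<^sub>R u) = L"
    using u \<delta> L by (simp add: \<epsilon>_def field_simps)
  with k have "k \<in> C L"
    using assms(4,7) L
    by (auto simp: open_curves_def closed_curves_def curve_length_le_iff pathstart_def pathfinish_def)

  \<comment> \<open>the displacement of the point of the curve assigned to \<open>X\<close>, without the spike: it depends
    on \<open>Xhat\<close> only, so that it is orthogonal to the residual\<close>
  define h where "h y = (if y \<in> B then y - (1 - \<epsilon>) *\<^sub>R z else \<epsilon> *\<^sub>R y)" for y
  have h_meas: "h \<in> borel_measurable borel" unfolding h_def by measurable
  have h_bound: "norm (h (Xhat \<omega>)) \<le> R + norm z" if "\<omega> \<in> space M" for \<omega>
  proof -
    have "norm ((1 - \<epsilon>) *\<^sub>R z) \<le> norm z" "norm (\<epsilon> *\<^sub>R Xhat \<omega>) \<le> norm (Xhat \<omega>)"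
      using \<epsilon> by (simp_all add: mult_left_le_one_le)
    then show ?thesis
      using Xhat_bound[OF that] norm_triangle_ineq4[of "Xhat \<omega>" "(1 - \<epsilon>) *\<^sub>R z"] norm_ge_zero[of z]
      unfolding h_def by (split if_split, intro conjI impI) linarith+
  qed
  note orth = residual_orthogonal[OF X X2 Xhat Xhat_bound ce h_meas h_bound]
  have int_Bg: "integrable M (\<lambda>\<omega>. indicator B (Xhat \<omega>) * g \<omega>)"
    by (rule Bochner_Integration.integrable_bound[OF int_g])
       (use borel_measurable_integrable[OF int_g] in \<open>auto simp: indicator_def\<close>)
  define bound where "bound \<omega> = (norm (X \<omega> - Xhat \<omega>))\<^sup>2 + 2 * ((X \<omega> - Xhat \<omega>) \<bullet> h (Xhat \<omega>))
      + 3 * \<epsilon>\<^sup>2 * R\<^sup>2 - 2 * \<delta> * (indicator B (Xhat \<omega>) * g \<omega>)" for \<omega>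
  have int_bound: "integrable M bound"
    unfolding bound_def using int_v2 orth(1) int_Bg by simp
  have pointwise: "(infdist (X \<omega>) (path_image k))\<^sup>2 \<le> bound \<omega>" if \<omega>: "\<omega> \<in> space M" for \<omega>
  proof -
    have near: "(infdist (X \<omega>) (path_image k))\<^sup>2 \<le> (norm (X \<omega> - y))\<^sup>2" if "y \<in> path_image k" for y
      using infdist_le[OF that, of "X \<omega>"] by (intro power_mono) (auto simp: dist_norm infdist_nonneg)
    show ?thesis
    proof (cases "Xhat \<omega> \<in> B")
      case True
      define s :: real where "s = (if 0 \<le> (X \<omega> - Xhat \<omega>) \<bullet> u then 1 else -1)"
      have "(1 - \<epsilon>) *\<^sub>R z + (s * \<delta>) *\<^sub>R u \<in> path_image k"
        using k_image by (simp add: s_def)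
      note near[OF this]
      also have "(norm (X \<omega> - ((1 - \<epsilon>) *\<^sub>R z + (s * \<delta>) *\<^sub>R u)))\<^sup>2 \<le> bound \<omega>"
        using spike_square_bound[of u "Xhat \<omega>" R z r \<epsilon> \<delta> c s "X \<omega>"] Xhat_bound[OF \<omega>] B_ball True
          u \<epsilon> \<delta> spike s_def
        by (auto simp: bound_def h_def g_def z_def dist_norm norm_minus_commute)
      finally show ?thesis .
    next
      case False
      obtain s where "s \<in> {0..1}" "Xhat \<omega> = f s"
        using assms(10) \<omega> by (auto simp: path_image_def)
      then have "(1 - \<epsilon>) *\<^sub>R Xhat \<omega> \<in> path_image (\<lambda>s. (1 - \<epsilon>) *\<^sub>R f s)"
        by (auto simp: path_image_def)
      with k_image(1) have "(1 - \<epsilon>) *\<^sub>R Xhat \<omega> \<in> path_image k" by blast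
      note near[OF this]
      also have "(norm (X \<omega> - (1 - \<epsilon>) *\<^sub>R Xhat \<omega>))\<^sup>2 \<le> bound \<omega>"
        using shrink_square_bound[OF Xhat_bound[OF \<omega>], of "X \<omega>" \<epsilon>] False
        by (simp add: bound_def h_def)
      finally show ?thesis .
    qed
  qed
  have "min_distortion M X (C L) \<le> distortion M X k"
    unfolding min_distortion_def
    by (rule cINF_lower[OF _ \<open>k \<in> C L\<close>]) (auto intro!: bdd_belowI[of _ 0] simp: distortion_def)
  also have "\<dots> \<le> (\<integral>\<omega>. bound \<omega> \<partial>M)"
    unfolding distortion_def by (rule integral_mono'[OF int_bound])
      (auto intro: pointwise order_trans[OF zero_le_power2 pointwise])
  also have "\<dots> = ?D + 3 * \<epsilon>\<^sup>2 * R\<^sup>2 - 2 * \<delta> * (\<integral>\<omega>. indicator B (Xhat \<omega>) * g \<omega> \<partial>M)"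
    unfolding bound_def using int_v2 orth int_Bg by (simp add: prob_space)
  also have "\<dots> < ?D"
  proof -
    have "2 * \<delta> * K < 2 * \<delta> * (\<integral>\<omega>. indicator B (Xhat \<omega>) * g \<omega> \<partial>M)"
      using heavy \<delta> by (intro mult_strict_left_mono) auto
    with budget show ?thesis by linarith
  qed
  finally show False using D assms(8) by simp
qed

end
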